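(* For all but finitely many $t\in\mathbb C$, the shuffle group $H(t)$ is the subgroup of the symmetric group on the six letters $\{\mathbb A,\mathbb B,\mathbb C,\mathbb D,\mathbb E,\mathbb F\}$ generated by the permutations $$u=(\mathbb A\,\mathbb D\,\mathbb C\,\mathbb F),\qquad v=(\mathbb A\,\mathbb D)(\mathbb B\,\mathbb E)(\mathbb C\,\mathbb F).$$
   Context: Let $\mathrm{LTR}=\{\mathbb A,\mathbb B,\mathbb C,\mathbb D,\mathbb E,\mathbb F\}$ be a set of six letters. A hexad is an injective map $h:\mathrm{LTR}\to\mathbb P^1_{\mathbb C}=\mathbb C\cup\{\infty\}$. A hexad $h$ is called an alignment if there exist a complex number $t'$ and a fractional linear transformation of $\mathbb P^1_{\mathbb C}$ taking $h(\mathbb A),h(\mathbb B),h(\mathbb C),h(\mathbb D),h(\mathbb E),h(\mathbb F)$ respectively to $0,\ t',\ \infty,\ 1,\ \frac{t'-1}{t'+1},\ -1$ (these six values are then necessarily distinct). For $t\in\mathbb C$ such that $0,t,\infty,1,\frac{t-1}{t+1},-1$ are six distinct points, let $h_t$ be the alignment $\mathbb A\mapsto 0$, $\mathbb B\mapsto t$, $\mathbb C\mapsto\infty$, $\mathbb D\mapsto 1$, $\mathbb E\mapsto\frac{t-1}{t+1}$, $\mathbb F\mapsto -1$. The shuffle group $H(t)$ consists of all bijections $z:\mathrm{LTR}\to\mathrm{LTR}$ such that $h_t\circ z$ is also an alignment. Cycle notation: $u=(\mathbb A\,\mathbb D\,\mathbb C\,\mathbb F)$ sends $\mathbb A\mapsto\mathbb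 D\mapsto\mathbb C\mapsto\mathbb F\mapsto\mathbb A$ and fixes $\mathbb B,\mathbb E$. *)

theory Defs
  imports Complex_Main "HOL-Library.Infinite_Set" "HOL-Combinatorics.Cycles"
    "HOL-Algebra.Bij" "HOL-Algebra.Generated_Groups"
begin

datatype ltr = \<A> | \<B> | \<C> | \<D> | \<E> | \<F>

text \<open>The complex projective line as the one-point extension of the complex numbers.\<close>

datatype cp1 = Fin complex | Inf

text \<open>The map given by \<open>z \<mapsto> (a z + b) / (c z + d)\<close>, with the usual values at the pole and at
  infinity. It is a fractional linear transformation only if \<open>a d - b c \<noteq> 0\<close>.\<close>

fun moebius :: "complex \<Rightarrow> complex \<Rightarrow> complex \<Rightarrow> complex \<Rightarrow> cp1 \<Rightarrow> cp1" where
  "moebius a b c d (Fin z) =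
     (if c * z + d = 0 then Inf else Fin ((a * z + b) / (c * z + d)))"
| "moebius a b c d Inf = (if c = 0 then Inf else Fin (a / c))"

definition frac_linear :: "(cp1 \<Rightarrow> cp1) \<Rightarrow> bool" where
  "frac_linear f \<longleftrightarrow> (\<exists>a b c d. a * d - b * c \<noteq> 0 \<and> f = moebius a b c d)"

definition hexad :: "(ltr \<Rightarrow> cp1) \<Rightarrow> bool" where
  "hexad h \<longleftrightarrow> inj h"

text \<open>The six values attached to a parameter \<open>t\<close>. The quotient \<open>(t - 1) / (t + 1)\<close> is formed in the
  projective line, so it is \<open>Inf\<close> for \<open>t = - 1\<close>. The map is a hexad only if the six values
  are distinct.\<close>

fun std_map :: "complex \<Rightarrow> ltr \<Rightarrow> cp1" where
  "std_map t \<A> = Fin 0"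
| "std_map t \<B> = Fin t"
| "std_map t \<C> = Inf"
| "std_map t \<D> = Fin 1"
| "std_map t \<E> = moebius 1 (- 1) 1 1 (Fin t)"
| "std_map t \<F> = Fin (- 1)"

definition alignment :: "(ltr \<Rightarrow> cp1) \<Rightarrow> bool" where
  "alignment h \<longleftrightarrow> hexad h \<and> (\<exists>t' f. frac_linear f \<and> (\<forall>x. f (h x) = std_map t' x))"

text \<open>Meaningful only when \<open>std_map t\<close> is a hexad.\<close>

definition shuffle_group :: "complex \<Rightarrow> (ltr \<Rightarrow> ltr) set" where
  "shuffle_group t = {z. bij z \<and> alignment (std_map t \<circ> z)}"

definition perm_u :: "ltr \<Rightarrow> ltr" where
  "perm_u = cycle_of_list [\<A>, \<D>, \<C>, \<F>]"

definition perm_v :: "ltr \<Rightarrow> ltr" where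
  "perm_v = cycle_of_list [\<A>, \<D>] \<circ> cycle_of_list [\<B>, \<E>] \<circ> cycle_of_list [\<C>, \<F>]"

end

theory Submission
  imports Defs "HOL-Computational_Algebra.Polynomial"
begin

text \<open>
  In homogeneous coordinates, an alignment satisfies two multihomogeneous equations between the
  \<open>2 \<times> 2\<close> brackets of its six points: \<open>\<A>\<close>, \<open>\<C>\<close> and \<open>\<D>\<close>, \<open>\<F>\<close> form a harmonic quadruple, and
  \<open>(t' - 1) / (t' + 1)\<close> is both the cross ratio that reads off the image of \<open>\<E>\<close> and one that
  involves \<open>\<B>\<close>, \<open>\<C>\<close>, \<open>\<D>\<close>, \<open>\<F>\<close>. For \<open>std_map t \<circ> z\<close> both equations are polynomial
  in \<open>t\<close>. Evaluating the polynomials at \<open>t = 4\<close> shows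
  that only for eight permutations \<open>z\<close> can both vanish identically, so every other \<open>z\<close> lies in
  \<open>H(t)\<close> for finitely many \<open>t\<close> only. The eight remaining permutations form the dihedral group
  generated by \<open>u\<close> and \<open>v\<close>, and explicit fractional linear transformations show that they belong
  to \<open>H(t)\<close> whenever the six standard values are distinct.
\<close>

section \<open>Bracket equations of an alignment\<close>

text \<open>The coordinates avoid division, with (t - 1 : t + 1) at \<open>\<E>\<close>, and live in
  any commutative ring, so that the same formulas serve for complex numbers, polynomials and
  integers.\<close>

fun coord1 :: "'a::comm_ring_1 \<Rightarrow> ltr \<Rightarrow> 'a" where
  "coord1 t \<A> = 0"
| "coord1 t \<B> = t"
| "coord1 t \<C> = 1"
| "coord1 t \<D> = 1"
| "coord1 t \<E> = t - 1"
| "coord1 t \<F> = - 1"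

fun coord2 :: "'a::comm_ring_1 \<Rightarrow> ltr \<Rightarrow> 'a" where
  "coord2 t \<A> = 1"
| "coord2 t \<B> = 1"
| "coord2 t \<C> = 0"
| "coord2 t \<D> = 1"
| "coord2 t \<E> = t + 1"
| "coord2 t \<F> = 1"

definition bracket :: "'a::comm_ring_1 \<Rightarrow> ltr \<Rightarrow> ltr \<Rightarrow> 'a" where
  "bracket t i j = coord1 t i * coord2 t j - coord1 t j * coord2 t i"

text \<open>The condition that the cross ratio (a, c; d, f) is -1, with denominators
  cleared.\<close>

definition harmonic :: "'a::comm_ring_1 \<Rightarrow> ltr \<Rightarrow> ltr \<Rightarrow> ltr \<Rightarrow> ltr \<Rightarrow> 'a" where
  "harmonic t a c d f = bracket t a d * bracket t c f + bracket t a f * bracket t c d"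

text \<open>Cleared form of an equality of cross ratios: the coordinate of \<open>e\<close> when
  \<open>a\<close>, \<open>d\<close>, \<open>c\<close> are moved to 0, 1, \<open>Inf\<close> against
  that of \<open>b\<close> when \<open>d\<close>, \<open>c\<close>, \<open>f\<close> are.\<close>

definition linked :: "'a::comm_ring_1 \<Rightarrow> ltr \<Rightarrow> ltr \<Rightarrow> ltr \<Rightarrow> ltr \<Rightarrow> ltr \<Rightarrow> ltr \<Rightarrow> 'a" where
  "linked t a b c d e f =
     bracket t a e * bracket t c d * bracket t f b * bracket t d c
     - bracket t d b * bracket t f c * bracket t c e * bracket t a d"

definition homog_coords :: "cp1 \<Rightarrow> complex \<Rightarrow> complex \<Rightarrow> bool" where
  "homog_coords p x y \<longleftrightarrow> (x \<noteq> 0 \<or> y \<noteq> 0) \<and> p = (if y = 0 then Inf else Fin (x / y))"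

text \<open>The two coordinates never vanish together: at \<open>\<E>\<close> they differ by
  2.\<close>

lemma homog_coords_std_map: "homog_coords (std_map t l) (coord1 t l) (coord2 t l)"
  by (cases l) (auto simp: homog_coords_def add_eq_0_iff)

lemma homog_coords_unique:
  assumes "homog_coords p x y" "homog_coords p x' y'"
  obtains k where "x = k * x'" "y = k * y'"
proof (cases "y = 0")
  case True
  then have "x = x / x' * x'" "y = x / x' * y'"
    using assms by (auto simp: homog_coords_def split: if_splits)
  then show ?thesis by (rule that)
next
  case False
  then have "x = y / y' * x'" "y = y / y' * y'"
    using assms by (auto simp: homog_coords_def field_simps split: if_splits)
  then show ?thesis by (rule that)
qed

lemma homog_coords_moebius:
  assumes "a * d - b * c \<noteq> 0" "homog_coords p x y"
  shows "homog_coords (moebius a b c d p) (a * x + b * y) (c * x + d * y)"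
proof -
  have nz: "a * x + b * y \<noteq> 0 \<or> c * x + d * y \<noteq> 0"
  proof (rule ccontr)
    assume "\<not> ?thesis"
    \<comment> \<open>The adjugate matrix takes the image vector back to the determinant times the
      vector of \<open>x\<close> and \<open>y\<close>.\<close>
    moreover have "(a * d - b * c) * x = d * (a * x + b * y) - b * (c * x + d * y)"
      "(a * d - b * c) * y = a * (c * x + d * y) - c * (a * x + b * y)"
      by (simp_all add: algebra_simps)
    ultimately have "x = 0" "y = 0" using assms(1) by auto
    with assms(2) show False by (simp add: homog_coords_def)
  qed
  show ?thesis
  proof (cases "y = 0")
    case True
    then show ?thesis using nz assms(2) by (auto simp: homog_coords_def)
  next
    case False
    then have "c * (x / y) + d = (c * x + d * y) / y" "a * (x / y) + b = (a * x + b * y) / y"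
      by (simp_all add: field_simps)
    then show ?thesis using nz assms(2) False by (auto simp: homog_coords_def)
  qed
qed

text \<open>The fractional linear map lifts to a linear map, which multiplies brackets by its
  determinant; the lifted vectors are the standard ones for \<open>t'\<close> up to factors
  \<open>m\<close>. So \<open>s\<close> is the inverse determinant.\<close>

lemma alignment_bracket:
  assumes "alignment (std_map t \<circ> z)"
  shows "\<exists>t' s m. \<forall>i j. bracket t (z i) (z j) = s * m i * m j * bracket t' i j"
proof -
  from assms obtain t' a b c d where det: "a * d - b * c \<noteq> 0"
    and eq: "\<And>l. moebius a b c d (std_map t (z l)) = std_map t' l"
    unfolding alignment_def frac_linear_def by auto
  define x y where "x = (\<lambda>l. coord1 t (z l))" and "y = (\<lambda>l. coord2 t (z l))"
  have "\<exists>k. a * x l + b * y l = k * coord1 t' l \<and> c * x l + d * y l = k * coord2 t' l" for l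
    using homog_coords_moebius[OF det homog_coords_std_map[of t "z l"]]
      homog_coords_std_map[of t' l]
    unfolding eq x_def y_def by (metis homog_coords_unique)
  then obtain m where m: "\<And>l. a * x l + b * y l = m l * coord1 t' l"
    "\<And>l. c * x l + d * y l = m l * coord2 t' l" by metis
  show ?thesis
  proof (intro exI allI)
    fix i j
    have "(a * d - b * c) * bracket t (z i) (z j) =
      (a * x i + b * y i) * (c * x j + d * y j) - (a * x j + b * y j) * (c * x i + d * y i)"
      by (simp add: bracket_def x_def y_def algebra_simps)
    also have "\<dots> = m i * m j * bracket t' i j"
      unfolding m by (simp add: bracket_def algebra_simps)
    finally show "bracket t (z i) (z j) = inverse (a * d - b * c) * m i * m j * bracket t' i j"
      using det by (simp add: field_simps)
  qed
qed

text \<open>Each point occurs equally often in every term, so the factors \<open>s\<close> and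
  \<open>m\<close> pull out; the cofactor belongs to the standard points for \<open>t'\<close> and
  is identically zero.\<close>

lemma alignment_equations:
  assumes "alignment (std_map t \<circ> z)"
  shows "harmonic t (z \<A>) (z \<C>) (z \<D>) (z \<F>) = 0"
    and "linked t (z \<A>) (z \<B>) (z \<C>) (z \<D>) (z \<E>) (z \<F>) = 0"
proof -
  obtain t' s m where "\<forall>i j. bracket t (z i) (z j) = s * m i * m j * bracket t' i j"
    using alignment_bracket[OF assms] by (elim exE)
  then have br: "bracket t (z i) (z j) = s * m i * m j * bracket t' i j" for i j
    by simp
  have "harmonic t (z \<A>) (z \<C>) (z \<D>) (z \<F>) =
      s * s * m \<A> * m \<C> * m \<D> * m \<F> * harmonic t' \<A> \<C> \<D> \<F>"
    unfolding harmonic_def br by (simp only: distrib_left ac_simps)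
  also have "harmonic t' \<A> \<C> \<D> \<F> = 0"
    by (simp add: harmonic_def bracket_def)
  finally show "harmonic t (z \<A>) (z \<C>) (z \<D>) (z \<F>) = 0"
    by simp
  have "linked t (z \<A>) (z \<B>) (z \<C>) (z \<D>) (z \<E>) (z \<F>) =
      s * s * s * s * m \<A> * m \<B> * m \<C> * m \<C> * m \<D> * m \<D> * m \<E> * m \<F> *
      linked t' \<A> \<B> \<C> \<D> \<E> \<F>"
    unfolding linked_def br by (simp only: right_diff_distrib ac_simps)
  also have "linked t' \<A> \<B> \<C> \<D> \<E> \<F> = 0"
    by (simp add: linked_def bracket_def algebra_simps)
  finally show "linked t (z \<A>) (z \<B>) (z \<C>) (z \<D>) (z \<E>) (z \<F>) = 0"
    by simp
qed

section \<open>Polynomial dependence on the parameter\<close>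

text \<open>Brackets use ring operations only, hence commute with ring homomorphisms such as
  evaluation.\<close>

lemma poly_bracket: "poly (bracket p i j) x = bracket (poly p x) i j"
  by (cases i; cases j) (simp_all add: bracket_def)

lemma poly_harmonic: "poly (harmonic p a c d f) x = harmonic (poly p x) a c d f"
  by (simp add: harmonic_def poly_bracket)

lemma poly_linked: "poly (linked p a b c d e f) x = linked (poly p x) a b c d e f"
  by (simp add: linked_def poly_bracket)

lemma bracket_of_int: "bracket (of_int n) i j = of_int (bracket n i j)"
  by (cases i; cases j) (simp_all add: bracket_def)

lemma harmonic_of_int: "harmonic (of_int n) a c d f = of_int (harmonic n a c d f)"
  by (simp add: harmonic_def bracket_of_int)

lemma linked_of_int: "linked (of_int n) a b c d e f = of_int (linked n a b c d e f)"
  by (simp add: linked_def bracket_of_int)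

lemma finite_zeros_of_nonzero_value:
  fixes P :: "complex poly"
  assumes "poly P x \<noteq> 0"
  shows "finite {t. poly P t = 0}"
  using assms by (intro poly_roots_finite) auto

text \<open>Inserting the variable \<open>[:0, 1:]\<close> gives a polynomial with these zeros; one
  nonzero integer value shows that it is not the zero polynomial.\<close>

lemma finite_harmonic_zeros:
  assumes "harmonic (n::int) a c d f \<noteq> 0"
  shows "finite {t::complex. harmonic t a c d f = 0}"
  using finite_zeros_of_nonzero_value[of "harmonic [:0, 1:] a c d f" "of_int n"] assms
  by (simp add: poly_harmonic harmonic_of_int)

lemma finite_linked_zeros:
  assumes "linked (n::int) a b c d e f \<noteq> 0"
  shows "finite {t::complex. linked t a b c d e f = 0}"
  using finite_zeros_of_nonzero_value[of "linked [:0, 1:] a b c d e f" "of_int n"] assms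
  by (simp add: poly_linked linked_of_int)

section \<open>The eight generic shuffles\<close>

text \<open>In order: id, u, u^2, u^3, v, vu, uv, u^2 v. Tuples of images, unlike functions, allow
  membership to be decided by evaluation.\<close>

definition dihedral :: "(ltr \<times> ltr \<times> ltr \<times> ltr \<times> ltr \<times> ltr) list" where
  "dihedral =
    [(\<A>, \<B>, \<C>, \<D>, \<E>, \<F>), (\<D>, \<B>, \<F>, \<C>, \<E>, \<A>),
     (\<C>, \<B>, \<A>, \<F>, \<E>, \<D>), (\<F>, \<B>, \<D>, \<A>, \<E>, \<C>),
     (\<D>, \<E>, \<F>, \<A>, \<B>, \<C>), (\<A>, \<E>, \<C>, \<F>, \<B>, \<D>),
     (\<C>, \<E>, \<A>, \<D>, \<B>, \<F>), (\<F>, \<E>, \<D>, \<C>, \<B>, \<A>)]"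

definition of_images :: "ltr \<times> ltr \<times> ltr \<times> ltr \<times> ltr \<times> ltr \<Rightarrow> ltr \<Rightarrow> ltr" where
  "of_images = (\<lambda>(a, b, c, d, e, f). case_ltr a b c d e f)"

lemma ltr_all: "(\<forall>x. P x) \<longleftrightarrow> P \<A> \<and> P \<B> \<and> P \<C> \<and> P \<D> \<and> P \<E> \<and> P \<F>"
  by (metis ltr.exhaust)

lemma ltr_UNIV: "UNIV = {\<A>, \<B>, \<C>, \<D>, \<E>, \<F>}"
  using ltr.exhaust by blast

lemma finite_ltr: "finite (UNIV :: ltr set)"
  by (simp add: ltr_UNIV)

lemma of_images_eta: "of_images (z \<A>, z \<B>, z \<C>, z \<D>, z \<E>, z \<F>) = z"
  by (simp add: of_images_def fun_eq_iff ltr_all)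

text \<open>A finite check at a parameter without accidental common solutions. The harmonic equation
  comes before the choice of \<open>b\<close> and \<open>e\<close>, which prunes the search.\<close>

lemma equations_at_4:
  "\<forall>a \<in> set [\<A>, \<B>, \<C>, \<D>, \<E>, \<F>]. \<forall>c \<in> set [\<A>, \<B>, \<C>, \<D>, \<E>, \<F>]. c \<noteq> a \<longrightarrow>
   (\<forall>d \<in> set [\<A>, \<B>, \<C>, \<D>, \<E>, \<F>]. d \<noteq> a \<longrightarrow> d \<noteq> c \<longrightarrow>
   (\<forall>f \<in> set [\<A>, \<B>, \<C>, \<D>, \<E>, \<F>]. f \<noteq> a \<longrightarrow> f \<noteq> c \<longrightarrow> f \<noteq> d \<longrightarrow>
     harmonic (4::int) a c d f = 0 \<longrightarrow>
   (\<forall>b \<in> set [\<A>, \<B>, \<C>, \<D>, \<E>, \<F>]. b \<noteq> a \<longrightarrow> b \<noteq> c \<longrightarrow> b \<noteq> d \<longrightarrow> b \<noteq> f \<longrightarrow>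
   (\<forall>e \<in> set [\<A>, \<B>, \<C>, \<D>, \<E>, \<F>]. e \<noteq> a \<longrightarrow> e \<noteq> b \<longrightarrow> e \<noteq> c \<longrightarrow> e \<noteq> d \<longrightarrow> e \<noteq> f \<longrightarrow>
     linked (4::int) a b c d e f = 0 \<longrightarrow> (a, b, c, d, e, f) \<in> set dihedral))))"
  by code_simp

lemma dihedral_if_equations_at_4:
  assumes "bij z" "harmonic (4::int) (z \<A>) (z \<C>) (z \<D>) (z \<F>) = 0"
    and "linked (4::int) (z \<A>) (z \<B>) (z \<C>) (z \<D>) (z \<E>) (z \<F>) = 0"
  shows "z \<in> of_images ` set dihedral"
proof -
  have inj: "z i = z j \<longleftrightarrow> i = j" for i j
    using assms(1) by (metis bij_def injD)
  have mem: "l \<in> set [\<A>, \<B>, \<C>, \<D>, \<E>, \<F>]" for l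
    by (cases l) auto
  have "(z \<A>, z \<B>, z \<C>, z \<D>, z \<E>, z \<F>) \<in> set dihedral"
    by (rule equations_at_4[rule_format, OF mem mem _ mem _ _ mem _ _ _ _ mem _ _ _ _ mem])
      (use assms inj in auto)
  then show ?thesis
    using of_images_eta[of z] by (metis imageI)
qed

text \<open>One of the two equations fails at 4, so it is a nonzero polynomial condition on
  \<open>t\<close> that every alignment must satisfy.\<close>

lemma finite_exceptional_parameters:
  assumes "bij z" "z \<notin> of_images ` set dihedral"
  shows "finite {t. alignment (std_map t \<circ> z)}"
proof (cases "harmonic (4::int) (z \<A>) (z \<C>) (z \<D>) (z \<F>) = 0")
  case False
  show ?thesis
    by (rule finite_subset[OF _ finite_harmonic_zeros[OF False]])
      (use alignment_equations in auto)
next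
  case True
  with assms have "linked (4::int) (z \<A>) (z \<B>) (z \<C>) (z \<D>) (z \<E>) (z \<F>) \<noteq> 0"
    using dihedral_if_equations_at_4 by blast
  from finite_linked_zeros[OF this] show ?thesis
    by (rule finite_subset[rotated]) (use alignment_equations in auto)
qed

text \<open>At 0, 1, -1 the point of \<open>\<B>\<close> meets a constant one, and it meets that of
  \<open>\<E>\<close> when t^2 = -1. The point of \<open>\<E>\<close> is 0, -1 or \<open>Inf\<close>
  only for t = 1, 0, -1 respectively, and never 1.\<close>

lemma hexad_std_map:
  assumes "t \<notin> {0, 1, - 1, \<i>, - \<i>}"
  shows "hexad (std_map t)"
proof -
  have nz: "t + 1 \<noteq> 0" using assms by (auto simp: add_eq_0_iff2)
  have 1: "(t - 1) / (t + 1) \<noteq> t"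
  proof
    assume "(t - 1) / (t + 1) = t"
    with nz have "t\<^sup>2 = - 1"
      by (simp add: field_simps power2_eq_square eq_neg_iff_add_eq_0)
    then have "t\<^sup>2 = \<i>\<^sup>2" by simp
    with assms show False unfolding power2_eq_iff by auto
  qed
  have 2: "(t - 1) / (t + 1) \<noteq> 1" "(t - 1) / (t + 1) \<noteq> - 1" "(t - 1) / (t + 1) \<noteq> 0"
    using assms nz by (auto simp: field_simps)
  have 3: "t \<noteq> 0" "t \<noteq> 1" "t \<noteq> - 1"
    using assms by auto
  show ?thesis
    using nz 1 2 3 1[symmetric] 2[symmetric] 3[symmetric] unfolding hexad_def inj_def ltr_all
    by simp
qed

lemma alignmentI:
  assumes "hexad (std_map t)" "bij z" "a * d - b * c \<noteq> 0"
    and "\<And>x. moebius a b c d (std_map t (z x)) = std_map t' x"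
  shows "alignment (std_map t \<circ> z)"
proof -
  have "hexad (std_map t \<circ> z)"
    using assms(1,2) by (simp add: hexad_def inj_compose bij_is_inj)
  moreover have "frac_linear (moebius a b c d)"
    using assms(3) by (auto simp: frac_linear_def)
  ultimately show ?thesis
    using assms(4) unfolding alignment_def by (metis comp_apply)
qed

lemma bij_of_images:
  assumes "p \<in> set dihedral"
  shows "bij (of_images p)"
proof -
  have "inj (of_images p)"
    using assms unfolding dihedral_def inj_def ltr_all by (auto simp: of_images_def)
  then show ?thesis
    by (simp add: bij_def finite_UNIV_inj_surj finite_ltr)
qed

lemma dihedral_subset_shuffle_group:
  assumes "t \<notin> {0, 1, - 1, \<i>, - \<i>}"
  shows "of_images ` set dihedral \<subseteq> shuffle_group t"
proof -
  have "t \<noteq> 0" "t + 1 \<noteq> 0" "1 + t \<noteq> 0" "t \<noteq> 1" "t \<noteq> - 1" "1 \<noteq> t"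
    using assms by (auto simp: add_eq_0_iff2 add_eq_0_iff minus_equation_iff[of t 1])
  moreover from this have "t * 2 + 2 \<noteq> 0"
    using mult_eq_0_iff[of 2 "t + 1"] by (simp add: algebra_simps)
  ultimately have t: "t \<noteq> 0" "t + 1 \<noteq> 0" "1 + t \<noteq> 0" "t \<noteq> 1" "t \<noteq> - 1" "1 \<noteq> t"
    "t * 2 + 2 \<noteq> 0"
    by simp_all
  have al: "alignment (std_map t \<circ> of_images p)"
    if "p \<in> set dihedral" "a * d - b * c \<noteq> 0"
      "\<forall>x. moebius a b c d (std_map t (of_images p x)) = std_map t' x" for p a d b c t'
    using that alignmentI[OF hexad_std_map[OF assms] bij_of_images] by blast
  \<comment> \<open>The arguments of \<open>al\<close> come in the order \<open>p\<close>,
    \<open>a\<close>, \<open>d\<close>, \<open>b\<close>, \<open>c\<close>, \<open>t'\<close>. Each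
    map is determined by sending the points now labelled \<open>\<A>\<close>, \<open>\<D>\<close>,
    \<open>\<C>\<close> to 0, 1, \<open>Inf\<close>; \<open>t'\<close> is the image of the point now
    labelled \<open>\<B>\<close>.\<close>
  have "alignment (std_map t \<circ> of_images (\<A>, \<B>, \<C>, \<D>, \<E>, \<F>))"
    by (rule al[of _ 1 1 0 0 t])
      (use t in \<open>simp_all add: dihedral_def of_images_def ltr_all divide_simps\<close>)
  moreover have "alignment (std_map t \<circ> of_images (\<D>, \<B>, \<F>, \<C>, \<E>, \<A>))"
    by (rule al[of _ 1 1 "- 1" 1 "(t - 1) / (t + 1)"])
      (use t in \<open>simp_all add: dihedral_def of_images_def ltr_all divide_simps\<close>)
  moreover have "alignment (std_map t \<circ> of_images (\<C>, \<B>, \<A>, \<F>, \<E>, \<D>))"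
    by (rule al[of _ 0 0 "- 1" 1 "- 1 / t"])
      (use t in \<open>simp_all add: dihedral_def of_images_def ltr_all divide_simps\<close>)
  moreover have "alignment (std_map t \<circ> of_images (\<F>, \<B>, \<D>, \<A>, \<E>, \<C>))"
    by (rule al[of _ 1 1 1 "- 1" "(1 + t) / (1 - t)"])
      (use t in \<open>simp_all add: dihedral_def of_images_def ltr_all divide_simps\<close>)
  moreover have "alignment (std_map t \<circ> of_images (\<D>, \<E>, \<F>, \<A>, \<B>, \<C>))"
    by (rule al[of _ "- 1" 1 1 1 "1 / t"])
      (use t in \<open>simp_all add: dihedral_def of_images_def ltr_all divide_simps\<close>)
  moreover have "alignment (std_map t \<circ> of_images (\<A>, \<E>, \<C>, \<F>, \<B>, \<D>))"
    by (rule al[of _ "- 1" 1 0 0 "(1 - t) / (1 + t)"])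
      (use t in \<open>simp_all add: dihedral_def of_images_def ltr_all divide_simps\<close>)
  moreover have "alignment (std_map t \<circ> of_images (\<C>, \<E>, \<A>, \<D>, \<B>, \<F>))"
    by (rule al[of _ 0 0 1 1 "(t + 1) / (t - 1)"])
      (use t in \<open>simp_all add: dihedral_def of_images_def ltr_all divide_simps\<close>)
  moreover have "alignment (std_map t \<circ> of_images (\<F>, \<E>, \<D>, \<C>, \<B>, \<A>))"
    by (rule al[of _ 1 "- 1" 1 1 "- t"])
      (use t in \<open>simp_all add: dihedral_def of_images_def ltr_all divide_simps, simp add: algebra_simps\<close>)
  ultimately have "\<forall>p \<in> set dihedral. alignment (std_map t \<circ> of_images p)"
    by (simp only: dihedral_def list.set ball_simps simp_thms)
  then show ?thesis
    using bij_of_images by (auto simp: shuffle_group_def)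
qed

section \<open>The group generated by \<open>u\<close> and \<open>v\<close>\<close>

lemma perm_u_images: "perm_u = of_images (\<D>, \<B>, \<F>, \<C>, \<E>, \<A>)"
  by (simp add: perm_u_def of_images_def fun_eq_iff ltr_all transpose_def)

lemma perm_v_images: "perm_v = of_images (\<D>, \<E>, \<F>, \<A>, \<B>, \<C>)"
  by (simp add: perm_v_def of_images_def fun_eq_iff ltr_all transpose_def)

lemma of_images_comp:
  "z \<circ> of_images (a, b, c, d, e, f) = of_images (z a, z b, z c, z d, z e, z f)"
  by (simp add: of_images_def fun_eq_iff ltr_all)

lemma dihedral_images_closed:
  "\<forall>p \<in> set dihedral. \<forall>(a, b, c, d, e, f) \<in> set dihedral.
     (of_images p a, of_images p b, of_images p c, of_images p d, of_images p e, of_images p f)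
       \<in> set dihedral"
  by code_simp

lemma dihedral_comp_closed:
  assumes "g \<in> of_images ` set dihedral" "h \<in> of_images ` set dihedral"
  shows "g \<circ> h \<in> of_images ` set dihedral"
  using assms dihedral_images_closed by (fastforce simp: of_images_comp)

text \<open>The group product is a restricted function, specified as composition only on
  bijections.\<close>

lemma mult_BijGroup_UNIV:
  assumes "bij g" "bij h"
  shows "g \<otimes>\<^bsub>BijGroup UNIV\<^esub> h = g \<circ> h"
  using assms by (simp add: BijGroup_def Bij_def compose_def fun_eq_iff)

lemma carrier_BijGroup_UNIV: "carrier (BijGroup UNIV) = {g. bij g}"
  by (auto simp: BijGroup_def Bij_def)

lemma one_BijGroup_UNIV: "\<one>\<^bsub>BijGroup UNIV\<^esub> = id"
  by (simp add: BijGroup_def fun_eq_iff)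

lemma inv_BijGroup_UNIV:
  assumes "bij g" "bij h" "h \<circ> g = id"
  shows "inv\<^bsub>BijGroup UNIV\<^esub> g = h"
  using assms
  by (intro group.inv_equality group_BijGroup)
    (simp_all add: mult_BijGroup_UNIV carrier_BijGroup_UNIV one_BijGroup_UNIV)

lemma id_images: "id = of_images (\<A>, \<B>, \<C>, \<D>, \<E>, \<F>)"
  by (simp add: of_images_def fun_eq_iff ltr_all)

text \<open>The eight maps include the generators and their inverses u^3 and v and are closed under
  composition; conversely, each is a product of copies of u and v.\<close>

lemma generate_eq_dihedral:
  "generate (BijGroup UNIV) {perm_u, perm_v} = of_images ` set dihedral"
    (is "?G = ?D")
proof
  have bij: "bij g" if "g \<in> ?D" for g
    using that bij_of_images by auto
  have u: "perm_u \<in> ?D" and v: "perm_v \<in> ?D" and one: "id \<in> ?D"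
    and w: "of_images (\<F>, \<B>, \<D>, \<A>, \<E>, \<C>) \<in> ?D"
    unfolding perm_u_images perm_v_images id_images by (simp_all add: dihedral_def)
  have inv_u: "inv\<^bsub>BijGroup UNIV\<^esub> perm_u = of_images (\<F>, \<B>, \<D>, \<A>, \<E>, \<C>)"
    using bij[OF u] bij[OF w]
    by (rule inv_BijGroup_UNIV) (simp add: perm_u_images of_images_def fun_eq_iff ltr_all)
  have inv_v: "inv\<^bsub>BijGroup UNIV\<^esub> perm_v = perm_v"
    using bij[OF v] bij[OF v]
    by (rule inv_BijGroup_UNIV) (simp add: perm_v_images of_images_def fun_eq_iff ltr_all)
  show "?G \<subseteq> ?D"
  proof
    fix g assume "g \<in> ?G"
    then show "g \<in> ?D"
    proof induction
      case one
      show ?case using \<open>id \<in> ?D\<close> by (simp only: one_BijGroup_UNIV)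
    next
      case (incl h)
      then show ?case using u v by auto
    next
      case (inv h)
      then show ?case using v w inv_u inv_v by auto
    next
      case (eng g h)
      then show ?case
        using bij dihedral_comp_closed by (simp only: mult_BijGroup_UNIV)
    qed
  qed
  \<comment> \<open>The inclusion just shown supplies the bijectivity that turns the group product
    into composition.\<close>
  have comp: "g \<circ> h \<in> ?G" if "g \<in> ?G" "h \<in> ?G" for g h
  proof -
    have "bij g" "bij h"
      using that \<open>?G \<subseteq> ?D\<close> bij by blast+
    then show ?thesis
      using generate.eng[OF that] by (simp only: mult_BijGroup_UNIV)
  qed
  have gens: "perm_u \<in> ?G" "perm_v \<in> ?G"
    by (simp_all add: generate.incl)
  have words: "of_images (\<A>, \<B>, \<C>, \<D>, \<E>, \<F>) = perm_v \<circ> perm_v"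
    "of_images (\<C>, \<B>, \<A>, \<F>, \<E>, \<D>) = perm_u \<circ> perm_u"
    "of_images (\<F>, \<B>, \<D>, \<A>, \<E>, \<C>) = perm_u \<circ> (perm_u \<circ> perm_u)"
    "of_images (\<A>, \<E>, \<C>, \<F>, \<B>, \<D>) = perm_v \<circ> perm_u"
    "of_images (\<C>, \<E>, \<A>, \<D>, \<B>, \<F>) = perm_u \<circ> perm_v"
    "of_images (\<F>, \<E>, \<D>, \<C>, \<B>, \<A>) = perm_u \<circ> (perm_u \<circ> perm_v)"
    by (simp_all add: perm_u_images perm_v_images of_images_def fun_eq_iff ltr_all)
  show "?D \<subseteq> ?G"
    unfolding dihedral_def
    by (simp add: words perm_u_images[symmetric] perm_v_images[symmetric] comp gens)
qed

theorem proposition4p2: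
  "\<forall>\<^sub>\<infinity>t. hexad (std_map t) \<and>
     shuffle_group t = generate (BijGroup (UNIV :: ltr set)) {perm_u, perm_v}"
proof -
  define D where "D = of_images ` set dihedral"
  \<comment> \<open>The degenerate parameters, together with the finitely many \<open>t\<close> that
    each of the finitely many permutations outside \<open>D\<close> can contribute.\<close>
  define S where "S = {0, 1, - 1, \<i>, - \<i>} \<union>
    (\<Union>z \<in> {z. bij z} - D. {t. alignment (std_map t \<circ> z)})"
  have "finite ({z :: ltr \<Rightarrow> ltr. bij z} - D)"
    by (rule finite_subset[OF _ finite_permutations[OF finite_ltr]])
      (auto simp: permutes_univ bij_iff)
  then have "finite S"
    unfolding S_def using finite_exceptional_parameters by (auto simp: D_def)
  moreover have "hexad (std_map t) \<and> shuffle_group t = D" if "t \<notin> S" for t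
  proof -
    from that have t: "t \<notin> {0, 1, - 1, \<i>, - \<i>}" by (simp add: S_def)
    have "shuffle_group t \<subseteq> D"
      using that by (auto simp: S_def shuffle_group_def)
    then show ?thesis
      using hexad_std_map[OF t] dihedral_subset_shuffle_group[OF t] by (auto simp: D_def)
  qed
  ultimately show ?thesis
    unfolding MOST_iff_cofinite generate_eq_dihedral D_def[symmetric]
    by (auto elim!: finite_subset[rotated])
qed

end
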